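(* Let $\mathcal B=(e_n)_{n=1}^\infty$ be a basis in a Banach space $\mathbb X$. (a) If $\mathcal B$ is partially-greedy with constant $C_p$, then $\mathcal B$ has the Property (F$^*_p$) with constant $\mathcal F^*_p\leq C_p(1+2C_p)$. (b) If $\mathcal B$ has the Property (F$^*_p$) with constant $\mathcal F^*_p$, then $\mathcal B$ is partially-greedy with constant $C_p\leq (\mathcal F^*_p)^2$.
   Context: $(\mathbb X,\|\cdot\|)$ is a Banach space over $\mathbb F=\mathbb R$ or $\mathbb C$. A basis means a semi-normalized Markushevich basis: a sequence $\mathcal B=(e_n)_{n=1}^\infty\subset\mathbb X$ with closed linear span $\mathbb X$ for which there is a unique sequence $(e_n^* )_{n=1}^\infty\subset\mathbb X^*$ with $e_n^*(e_m)=\delta_{n,m}$, such that $e_n^*(f)=0$ for all $n$ implies $f=0$, and $0<\inf_n\min\{\|e_n\|,\|e_n^*\|\}\le\sup_n\max\{\|e_n\|,\|e_n^*\|\}<\infty$. Notation: $\mathrm{supp}(f)=\{n: e_n^*(f)\ne0\}$; $\mathbb X_{fin}$ is the subspace of elements with finite support; $f\cdot g=0$ means $\mathrm{supp}(f)\cap\mathrm{supp}(g)=\emptyset$; $\tilde f=(e_n^*(f))_n$ and $\|\tilde f\|_\infty=\sup_n|e_n^*(f)|$; for a finite set $B\subset\mathbb N$, $P_B(f)=\sum_{n\in B}e_n^*(f)e_n$; $S_k(f)=P_{\{1,\dots,k\}}(f)$, with $S_0(f)=0$. For finite sets $A,B\subset\mathbb N$, $A<B$ means $\max A<\min B$ (vacuously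 true if one of them is empty). An infimum over the empty set is $+\infty$. A greedy set of order $m$ for $f\in\mathbb X$ is a set $A\subset\mathbb N$ with $|A|=m$ and $\min_{n\in A}|e_n^*(f)|\ge\max_{n\notin A}|e_n^*(f)|$; $\mathcal G_m(f)=P_A(f)$ for such a set $A$ is called a greedy sum of order $m$. Partially-greedy: there is $C>0$ with $\|f-\mathcal G_m(f)\|\le C\inf_{0\le k\le m}\|f-S_k(f)\|$ for all $m\in\mathbb N$, all $f\in\mathbb X$ and every greedy sum $\mathcal G_m(f)$; the least such constant is $C_p$. Property (F$^*_p$): there is $C>0$ such that $\|f+z\|\le C\|f+y\|$ for all $f,z,y\in\mathbb X_{fin}$ satisfying: (i) $f\cdot z=0$, $f\cdot y=0$, $z\cdot y=0$; (ii) $\max\{\|\tilde f\|_\infty,\|\tilde z\|_\infty\}\le1$; (iii) $|D|\ge|\mathrm{supp}(z)|$, where $D=\{n\in\mathrm{supp}(y): |e_n^*(y)|=1\}$; (iv) $\inf_{n\in\mathrm{supp}(y)}|e_n^*(y)|\ge\|\tilde f\|_\infty$; and (v) $\mathrm{supp}(z)<\mathrm{supp}(f+y)$. The least such constant is $\mathcal F^*_p$. *)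

theory Defs
  imports "HOL-Analysis.Analysis" "HOL-Library.Extended_Real"
begin

text \<open>
  The scalar field is a type \<open>'k\<close> of class \<open>real_normed_field\<close>; \<open>real\<close> and \<open>complex\<close> are
  instances and, by Gelfand--Mazur, up to isometric isomorphism the only ones. The class \<open>banach\<close>
  supplies the norm, the completeness and the real scaling of the space; the locale adds a
  compatible scalar multiplication by \<open>'k\<close>.
\<close>

locale banach_space_over = vector_space smul
  for smul :: "'k::real_normed_field \<Rightarrow> 'a::banach \<Rightarrow> 'a" +
  assumes smul_of_real: "smul (of_real r) x = r *\<^sub>R x"
    and norm_smul: "norm (smul c x) = norm c * norm x"

definition continuous_functional ::
    "('k::real_normed_field \<Rightarrow> 'a::banach \<Rightarrow> 'a) \<Rightarrow> ('a \<Rightarrow> 'k) \<Rightarrow> bool" where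
  "continuous_functional smul \<phi> \<longleftrightarrow> Vector_Spaces.linear smul (*) \<phi> \<and> bounded_linear \<phi>"

definition biorthogonal ::
    "('k::real_normed_field \<Rightarrow> 'a::banach \<Rightarrow> 'a) \<Rightarrow> (nat \<Rightarrow> 'a) \<Rightarrow> (nat \<Rightarrow> 'a \<Rightarrow> 'k) \<Rightarrow> bool" where
  "biorthogonal smul e es \<longleftrightarrow>
     (\<forall>n. continuous_functional smul (es n)) \<and>
     (\<forall>n m. es n (e m) = (if n = m then 1 else 0))"

text \<open>
  Sequences are indexed from \<open>0\<close>, so \<open>e n\<close> is the basis vector usually written $e_{n+1}$, and the
  partial sum \<open>S\<^sub>k\<close> below runs over \<open>{..<k}\<close>. The coordinate functionals \<open>es\<close> are a parameter, but
  they are determined by \<open>e\<close>. The norm of \<open>es n\<close> in the dual space is \<open>onorm\<close>.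
\<close>

definition markushevich_basis ::
    "('k::real_normed_field \<Rightarrow> 'a::banach \<Rightarrow> 'a) \<Rightarrow> (nat \<Rightarrow> 'a) \<Rightarrow> (nat \<Rightarrow> 'a \<Rightarrow> 'k) \<Rightarrow> bool" where
  "markushevich_basis smul e es \<longleftrightarrow>
     closure (module.span smul (range e)) = UNIV \<and>
     biorthogonal smul e es \<and> (\<forall>es'. biorthogonal smul e es' \<longrightarrow> es' = es) \<and>
     (\<forall>f. (\<forall>n. es n f = 0) \<longrightarrow> f = 0)"

definition semi_normalized :: "(nat \<Rightarrow> 'a::banach) \<Rightarrow> (nat \<Rightarrow> 'a \<Rightarrow> 'k::real_normed_field) \<Rightarrow> bool" where
  "semi_normalized e es \<longleftrightarrow>
     0 < (INF n. min (norm (e n)) (onorm (es n))) \<and>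
     bdd_above (range (\<lambda>n. max (norm (e n)) (onorm (es n))))"

definition supp :: "(nat \<Rightarrow> 'a \<Rightarrow> 'k::real_normed_field) \<Rightarrow> 'a \<Rightarrow> nat set" where
  "supp es f = {n. es n f \<noteq> 0}"

definition X_fin :: "(nat \<Rightarrow> 'a \<Rightarrow> 'k::real_normed_field) \<Rightarrow> 'a set" where
  "X_fin es = {f. finite (supp es f)}"

definition coeff_sup :: "(nat \<Rightarrow> 'a \<Rightarrow> 'k::real_normed_field) \<Rightarrow> 'a \<Rightarrow> real" where
  "coeff_sup es f = (SUP n. norm (es n f))"

definition coord_proj ::
    "('k::real_normed_field \<Rightarrow> 'a::banach \<Rightarrow> 'a) \<Rightarrow> (nat \<Rightarrow> 'a) \<Rightarrow> (nat \<Rightarrow> 'a \<Rightarrow> 'k) \<Rightarrow> nat set \<Rightarrow> 'a \<Rightarrow> 'a" where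
  "coord_proj smul e es B f = (\<Sum>n\<in>B. smul (es n f) (e n))"

definition partial_sum ::
    "('k::real_normed_field \<Rightarrow> 'a::banach \<Rightarrow> 'a) \<Rightarrow> (nat \<Rightarrow> 'a) \<Rightarrow> (nat \<Rightarrow> 'a \<Rightarrow> 'k) \<Rightarrow> nat \<Rightarrow> 'a \<Rightarrow> 'a" where
  "partial_sum smul e es k f = coord_proj smul e es {..<k} f"

definition greedy_set :: "(nat \<Rightarrow> 'a \<Rightarrow> 'k::real_normed_field) \<Rightarrow> nat \<Rightarrow> 'a \<Rightarrow> nat set \<Rightarrow> bool" where
  "greedy_set es m f A \<longleftrightarrow>
     finite A \<and> card A = m \<and> (\<forall>n\<in>A. \<forall>j. j \<notin> A \<longrightarrow> norm (es n f) \<ge> norm (es j f))"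

text \<open>The order \<open>m\<close> of a greedy sum is a positive integer, while \<open>k\<close> is allowed to be \<open>0\<close>.\<close>

definition partially_greedy_with ::
    "('k::real_normed_field \<Rightarrow> 'a::banach \<Rightarrow> 'a) \<Rightarrow> (nat \<Rightarrow> 'a) \<Rightarrow> (nat \<Rightarrow> 'a \<Rightarrow> 'k) \<Rightarrow> real \<Rightarrow> bool" where
  "partially_greedy_with smul e es C \<longleftrightarrow> C > 0 \<and>
     (\<forall>m\<ge>1. \<forall>f A. greedy_set es m f A \<longrightarrow>
        norm (f - coord_proj smul e es A f)
          \<le> C * (INF k\<in>{0..m}. norm (f - partial_sum smul e es k f)))"

definition partially_greedy ::
    "('k::real_normed_field \<Rightarrow> 'a::banach \<Rightarrow> 'a) \<Rightarrow> (nat \<Rightarrow> 'a) \<Rightarrow> (nat \<Rightarrow> 'a \<Rightarrow> 'k) \<Rightarrow> bool" where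
  "partially_greedy smul e es \<longleftrightarrow> (\<exists>C. partially_greedy_with smul e es C)"

definition partially_greedy_const ::
    "('k::real_normed_field \<Rightarrow> 'a::banach \<Rightarrow> 'a) \<Rightarrow> (nat \<Rightarrow> 'a) \<Rightarrow> (nat \<Rightarrow> 'a \<Rightarrow> 'k) \<Rightarrow> real" where
  "partially_greedy_const smul e es = (LEAST C. partially_greedy_with smul e es C)"

text \<open>
  In condition (iv) the infimum is taken in \<open>ereal\<close>, where it is \<open>\<infinity>\<close> if \<open>y = 0\<close>.
\<close>

definition Fp_admissible :: "(nat \<Rightarrow> 'a::banach \<Rightarrow> 'k::real_normed_field) \<Rightarrow> 'a \<Rightarrow> 'a \<Rightarrow> 'a \<Rightarrow> bool" where
  "Fp_admissible es f z y \<longleftrightarrow>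
     f \<in> X_fin es \<and> z \<in> X_fin es \<and> y \<in> X_fin es \<and>
     (supp es f \<inter> supp es z = {} \<and> supp es f \<inter> supp es y = {} \<and> supp es z \<inter> supp es y = {}) \<and>
     max (coeff_sup es f) (coeff_sup es z) \<le> 1 \<and>
     card {n \<in> supp es y. norm (es n y) = 1} \<ge> card (supp es z) \<and>
     (INF n\<in>supp es y. ereal (norm (es n y))) \<ge> ereal (coeff_sup es f) \<and>
     (\<forall>i\<in>supp es z. \<forall>j\<in>supp es (f + y). i < j)"

definition property_Fp_with :: "(nat \<Rightarrow> 'a::banach \<Rightarrow> 'k::real_normed_field) \<Rightarrow> real \<Rightarrow> bool" where
  "property_Fp_with es C \<longleftrightarrow> C > 0 \<and>
     (\<forall>f z y. Fp_admissible es f z y \<longrightarrow> norm (f + z) \<le> C * norm (f + y))"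

definition property_Fp :: "(nat \<Rightarrow> 'a::banach \<Rightarrow> 'k::real_normed_field) \<Rightarrow> bool" where
  "property_Fp es \<longleftrightarrow> (\<exists>C. property_Fp_with es C)"

definition Fp_const :: "(nat \<Rightarrow> 'a::banach \<Rightarrow> 'k::real_normed_field) \<Rightarrow> real" where
  "Fp_const es = (LEAST C. property_Fp_with es C)"

end

theory Submission
  imports Defs
begin

text \<open>
  Coordinates determine a vector, so every algebraic identity below is checked coordinatewise.

  Partially greedy implies Property (F), with \<open>C\<close> the partially greedy constant.  The support of
  \<open>y\<close> is a greedy set of \<open>f + y\<close>, so \<open>\<parallel>f\<parallel> \<le> C \<parallel>f + y\<parallel>\<close>.  The set \<open>E\<close> on which \<open>y\<close> has
  coefficients of modulus at least \<open>1\<close> is a greedy set of \<open>f + y\<close> as well, so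
  \<open>\<parallel>P\<^sub>E y\<parallel> \<le> (1 + C) \<parallel>f + y\<parallel>\<close>.  To compare \<open>z\<close> with \<open>P\<^sub>E y\<close>, note that \<open>z\<close> lives on an initial
  segment that \<open>E\<close> avoids.  Put coefficients \<open>1\<close> in the gaps of this segment: removing the gaps
  together with \<open>E\<close> is a greedy step that leaves \<open>z\<close>, while removing the whole segment leaves
  \<open>P\<^sub>E y\<close>, and \<open>|E| \<ge> |supp z|\<close> says that the greedy step removes at least as many terms.
  Hence \<open>\<parallel>z\<parallel> \<le> C \<parallel>P\<^sub>E y\<parallel>\<close>, and \<open>C + C (1 + C) \<le> C (1 + 2 C)\<close> because \<open>C \<ge> 1\<close>.

  Property (F) implies partially greedy, with \<open>F\<close> its constant.  If \<open>f\<close> has a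
  zero coefficient on the greedy set \<open>A\<close>, then \<open>f = P\<^sub>A f\<close>. Otherwise, after scaling, \<open>A\<close>
  separates the coefficients of modulus at least \<open>1\<close> from those of modulus at most \<open>1\<close>.
  Write \<open>B\<close> for the initial segment of the partial sum, and \<open>h\<close> for the part of \<open>f\<close> outside
  \<open>A \<union> B\<close>.  Property (F) exchanges \<open>P\<^bsub>B-A\<^esub> f\<close> for the sum of the unimodular signs of \<open>f\<close> on \<open>A - B\<close>,
  which costs one factor \<open>F\<close>.  The second factor is the cost of passing from the signs on \<open>A - B\<close>
  back to \<open>P\<^bsub>A-B\<^esub> f\<close>: the vector with signs is an average of vectors obtained from
  \<open>h + P\<^bsub>A-B\<^esub> f = f - P\<^sub>B f\<close> by deleting its largest coefficients
  (\<open>norm_weighted_sum_le\<close>), and each deletion is an instance of Property (F) with \<open>z = 0\<close>.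
  This settles finitely supported \<open>f\<close>; the general case follows by an approximation that
  keeps \<open>A\<close> greedy.

  Since both conditions are families of closed inequalities in the constant, and the constant
  cannot drop below \<open>1\<close>, the least constants are attained, which turns the implications
  into the estimates for the least constants.
\<close>

section \<open>Attainment of optimal constants\<close>

text \<open>
  The admissible constants form a closed set. The pair \<open>(a, a)\<close> keeps them away from \<open>0\<close>, where
  the condition \<open>C > 0\<close> would destroy closedness.
\<close>

lemma Least_ratio_bound:
  fixes P :: "real \<Rightarrow> bool"
  assumes P_iff: "\<And>C. P C \<longleftrightarrow> C > 0 \<and> (\<forall>(a, b) \<in> S. a \<le> C * b)"
    and nonneg: "\<And>a b. (a, b) \<in> S \<Longrightarrow> b \<ge> 0"
    and diag: "(a, a) \<in> S" "a > 0"
    and ex: "\<exists>C. P C"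
  shows "P (LEAST C. P C)" "P C \<Longrightarrow> (LEAST C. P C) \<le> C" "P C \<Longrightarrow> 1 \<le> C"
proof -
  have ge1: "1 \<le> C" if "P C" for C
  proof -
    have "a \<le> C * a" using that diag P_iff[of C] by auto
    then show ?thesis using diag(2) by simp
  qed
  define c where "c = Inf (Collect P)"
  have bdd: "bdd_below (Collect P)" using ge1 by (auto intro!: bdd_belowI[of _ 1])
  have ne: "Collect P \<noteq> {}" using ex by auto
  have lower: "c \<le> C" if "P C" for C
    unfolding c_def using that bdd by (auto intro: cInf_lower)
  have c1: "1 \<le> c" unfolding c_def using ne ge1 by (auto intro: cInf_greatest)
  have "a' \<le> c * b" if ab: "(a', b) \<in> S" for a' b
  proof (cases "b = 0")
    case True
    then show ?thesis using ex ab P_iff by fastforce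
  next
    case False
    then have b: "b > 0" using nonneg[OF ab] by simp
    have "a' / b \<le> c" unfolding c_def
    proof (rule cInf_greatest[OF ne])
      fix C assume "C \<in> Collect P"
      then have "a' \<le> C * b" using ab P_iff by fastforce
      then show "a' / b \<le> C" using b by (simp add: field_simps)
    qed
    then show ?thesis using b by (simp add: field_simps)
  qed
  then have Pc: "P c" using P_iff c1 by auto
  have "(LEAST C. P C) = c" by (rule Least_equality) (use Pc lower in auto)
  then show "P (LEAST C. P C)" "P C \<Longrightarrow> (LEAST C. P C) \<le> C" "P C \<Longrightarrow> 1 \<le> C"
    using Pc lower ge1 by auto
qed

section \<open>Weighted sums as averages of subsums\<close>

text \<open>
  The weighted sum is the integral over \<open>t \<in> [0, 1]\<close> of the subsums over \<open>{n. t \<le> w n}\<close>, because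
  the term with index \<open>n\<close> is present exactly for \<open>t\<close> in an interval of length \<open>w n\<close>.
\<close>

lemma norm_weighted_sum_le:
  fixes u :: "'i \<Rightarrow> 'b::real_normed_vector"
  assumes "finite D" and w: "\<And>n. n \<in> D \<Longrightarrow> 0 \<le> w n \<and> w n \<le> 1"
    and le: "\<And>t. 0 \<le> t \<Longrightarrow> t \<le> 1 \<Longrightarrow> norm (v + (\<Sum>n\<in>{n\<in>D. t \<le> w n}. u n)) \<le> R"
  shows "norm (v + (\<Sum>n\<in>D. w n *\<^sub>R u n)) \<le> R"
proof -
  have ind: "((\<lambda>t. indicat_real {0..w n} t *\<^sub>R u n) has_integral w n *\<^sub>R u n) {0..1}"
    if n: "n \<in> D" for n
  proof -
    have sub: "{0..w n} \<subseteq> {0..1}" using w[OF n] by auto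
    have "((\<lambda>_. 1::real) has_integral w n) {0..w n}"
      using has_integral_const_real[of "1::real" 0 "w n"] w[OF n] by simp
    then have "((\<lambda>t. if t \<in> {0..w n} then 1 else 0::real) has_integral w n) {0..1}"
      using has_integral_restrict[OF sub, of "\<lambda>_. 1::real" "w n"] by simp
    moreover have "(\<lambda>t. if t \<in> {0..w n} then 1 else 0::real) = indicat_real {0..w n}"
      by (auto simp: indicator_def)
    ultimately have "(indicat_real {0..w n} has_integral w n) {0..1}" by metis
    then show ?thesis
      using has_integral_linear[OF _ bounded_linear_scaleR_left[of "u n"]] by (simp add: o_def)
  qed
  have "((\<lambda>_. v) has_integral v) {0..1::real}"
    using has_integral_const_real[of v 0 1] by simp
  then have I: "((\<lambda>t. v + (\<Sum>n\<in>D. indicat_real {0..w n} t *\<^sub>R u n)) has_integral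
      v + (\<Sum>n\<in>D. w n *\<^sub>R u n)) {0..1}"
    using \<open>finite D\<close> ind by (intro has_integral_add has_integral_sum)
  have bound: "norm (v + (\<Sum>n\<in>D. indicat_real {0..w n} t *\<^sub>R u n)) \<le> R" if t: "t \<in> {0..1}" for t
  proof -
    have "(\<Sum>n\<in>D. indicat_real {0..w n} t *\<^sub>R u n) = (\<Sum>n\<in>D. if t \<le> w n then u n else 0)"
      using t by (intro sum.cong) (auto simp: indicator_def)
    also have "\<dots> = (\<Sum>n\<in>{n\<in>D. t \<le> w n}. u n)"
      using \<open>finite D\<close> by (simp add: sum.inter_filter)
    finally show ?thesis using le[of t] t by simp
  qed
  have "0 \<le> R" using order_trans[OF norm_ge_zero bound[of 0]] by simp
  then show ?thesis
    using has_integral_bound_real[OF _ finite.emptyI I] bound by simp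
qed

section \<open>Coordinates\<close>

locale coordinate_basis = banach_space_over smul
  for smul :: "'k::real_normed_field \<Rightarrow> 'a::banach \<Rightarrow> 'a" +
  fixes e :: "nat \<Rightarrow> 'a" and es :: "nat \<Rightarrow> 'a \<Rightarrow> 'k"
  assumes basis: "markushevich_basis smul e es"
    and seminorm: "semi_normalized e es"
begin

lemma bounded_linear_es: "bounded_linear (es n)"
  and es_smul [simp]: "es n (smul c x) = c * es n x"
  and es_e: "es n (e m) = (if n = m then 1 else 0)"
proof -
  have "biorthogonal smul e es" using basis by (simp add: markushevich_basis_def)
  then have *: "Vector_Spaces.linear smul (*) (es n)" "bounded_linear (es n)"
    and "es n (e m) = (if n = m then 1 else 0)"
    by (auto simp: biorthogonal_def continuous_functional_def)
  then show "bounded_linear (es n)" "es n (e m) = (if n = m then 1 else 0)" by auto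
  show "es n (smul c x) = c * es n x"
    using *(1) by (simp add: Vector_Spaces.linear_iff_module_hom module_hom.scale)
qed

lemma es_linear [simp]:
  "es n 0 = 0" "es n (x + y) = es n x + es n y" "es n (x - y) = es n x - es n y"
  "es n (r *\<^sub>R x) = r *\<^sub>R es n x"
  using bounded_linear.linear[OF bounded_linear_es[of n]]
  by (simp_all add: linear_0 linear_add linear_diff linear_cmul)

lemma es_combination [simp]:
  assumes "finite B"
  shows "es n (\<Sum>m\<in>B. smul (a m) (e m)) = (if n \<in> B then a n else 0)"
proof -
  have "es n (\<Sum>m\<in>B. smul (a m) (e m)) = (\<Sum>m\<in>B. es n (smul (a m) (e m)))"
    by (rule linear_sum[OF bounded_linear.linear[OF bounded_linear_es]])
  also have "\<dots> = (\<Sum>m\<in>B. if n = m then a m else 0)"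
    by (intro sum.cong) (auto simp: es_e)
  finally show ?thesis using assms by simp
qed

lemma es_coord_proj [simp]:
  "finite B \<Longrightarrow> es n (coord_proj smul e es B f) = (if n \<in> B then es n f else 0)"
  by (simp add: coord_proj_def)

lemma coordinates_eqI: "(\<And>n. es n x = es n y) \<Longrightarrow> x = y"
  using basis unfolding markushevich_basis_def
  by (metis es_linear(3) right_minus_eq)

lemma e_nonzero: "e n \<noteq> 0"
  using es_e[of n n] by fastforce

lemma coord_proj_scaleR: "finite B \<Longrightarrow>
    coord_proj smul e es B (r *\<^sub>R f) = r *\<^sub>R coord_proj smul e es B f"
  by (rule coordinates_eqI) simp

lemma bounded_linear_coord_proj: "bounded_linear (coord_proj smul e es B)"
proof -
  have "bounded_linear (\<lambda>c. smul c v)" for v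
  proof (rule bounded_linear_intro[where K = "norm v"])
    fix r :: real and c :: 'k
    show "smul (r *\<^sub>R c) v = r *\<^sub>R smul c v"
      by (metis scaleR_conv_of_real scale_scale smul_of_real)
  qed (simp_all add: scale_left_distrib norm_smul)
  then have "bounded_linear (\<lambda>f. smul (es n f) (e n))" for n
    using bounded_linear_compose bounded_linear_es by blast
  then have "bounded_linear (\<lambda>f. \<Sum>n\<in>B. smul (es n f) (e n))"
    by (rule bounded_linear_sum)
  then show ?thesis by (simp add: coord_proj_def[abs_def])
qed

lemma coefficients_bounded: "\<exists>c>0. \<forall>n x. norm (es n x) \<le> c * norm x"
proof -
  obtain c where c: "\<And>n. max (norm (e n)) (onorm (es n)) \<le> c"
    using seminorm by (auto simp: semi_normalized_def bdd_above_def)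
  have "norm (es n x) \<le> c * norm x" for n x
    using onorm[OF bounded_linear_es[of n], of x] c[of n]
      mult_right_mono[of "onorm (es n)" c "norm x"] by simp
  moreover have "0 < c" using c[of 0] e_nonzero[of 0]
    by (metis less_le_trans max.boundedE zero_less_norm_iff)
  ultimately show ?thesis by blast
qed

lemma in_X_fin: "f \<in> X_fin es \<longleftrightarrow> finite {n. es n f \<noteq> 0}"
  by (simp add: X_fin_def supp_def)

lemma X_finI: "finite B \<Longrightarrow> (\<And>n. n \<notin> B \<Longrightarrow> es n f = 0) \<Longrightarrow> f \<in> X_fin es"
  unfolding in_X_fin by (rule finite_subset[of _ B]) auto

lemma X_fin_dense: "\<delta> > 0 \<Longrightarrow> \<exists>h \<in> X_fin es. norm (h - f) < \<delta>"
proof -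
  assume "\<delta> > 0"
  moreover have "f \<in> closure (span (range e))"
    using basis by (simp add: markushevich_basis_def)
  ultimately obtain h where h: "h \<in> span (range e)" "norm (h - f) < \<delta>"
    by (auto simp: closure_approachable dist_norm)
  have "h \<in> X_fin es" using h(1)
  proof (induction rule: span_induct_alt)
    case base
    show ?case by (simp add: in_X_fin)
  next
    case (step c x y)
    then obtain m where "x = e m" by auto
    then have "{n. es n (smul c x + y) \<noteq> 0} \<subseteq> insert m {n. es n y \<noteq> 0}"
      by (auto simp: es_e split: if_splits)
    then show ?case using step(2) unfolding in_X_fin by (meson finite_insert finite_subset)
  qed
  then show ?thesis using h(2) by blast
qed

section \<open>The two conditions in terms of coordinates\<close>

lemma coeff_sup_le_iff:
  assumes "f \<in> X_fin es"
  shows "coeff_sup es f \<le> c \<longleftrightarrow> (\<forall>n. norm (es n f) \<le> c)"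
proof -
  have "range (\<lambda>n. norm (es n f)) \<subseteq> insert 0 ((\<lambda>n. norm (es n f)) ` {n. es n f \<noteq> 0})" by auto
  then have "finite (range (\<lambda>n. norm (es n f)))"
    using assms unfolding in_X_fin by (meson finite_imageI finite_insert finite_subset)
  then have "bdd_above (range (\<lambda>n. norm (es n f)))" by (rule bdd_above_finite)
  then show ?thesis unfolding coeff_sup_def by (simp add: cSUP_le_iff)
qed

lemma Fp_admissible_iff:
  "Fp_admissible es f z y \<longleftrightarrow>
     f \<in> X_fin es \<and> z \<in> X_fin es \<and> y \<in> X_fin es \<and>
     (\<forall>n. (es n f = 0 \<or> es n z = 0) \<and> (es n f = 0 \<or> es n y = 0) \<and> (es n z = 0 \<or> es n y = 0)) \<and>
     (\<forall>n. norm (es n f) \<le> 1 \<and> norm (es n z) \<le> 1) \<and>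
     card {n. es n z \<noteq> 0} \<le> card {n. norm (es n y) = 1} \<and>
     (\<forall>n j. es n y \<noteq> 0 \<longrightarrow> norm (es j f) \<le> norm (es n y)) \<and>
     (\<forall>i j. es i z \<noteq> 0 \<longrightarrow> es j f \<noteq> 0 \<or> es j y \<noteq> 0 \<longrightarrow> i < j)"
proof (cases "f \<in> X_fin es \<and> z \<in> X_fin es \<and> y \<in> X_fin es \<and>
    (\<forall>n. (es n f = 0 \<or> es n z = 0) \<and> (es n f = 0 \<or> es n y = 0) \<and> (es n z = 0 \<or> es n y = 0))")
  case True
  have "es j (f + y) \<noteq> 0 \<longleftrightarrow> es j f \<noteq> 0 \<or> es j y \<noteq> 0" for j
    using True by (metis add.left_neutral add.right_neutral es_linear(2))
  moreover have "{n. es n y \<noteq> 0 \<and> norm (es n y) = 1} = {n. norm (es n y) = 1}" by auto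
  moreover have "(INF n\<in>supp es y. ereal (norm (es n y))) \<ge> ereal (coeff_sup es f) \<longleftrightarrow>
      (\<forall>n j. es n y \<noteq> 0 \<longrightarrow> norm (es j f) \<le> norm (es n y))"
    using True by (auto simp: le_INF_iff supp_def coeff_sup_le_iff)
  moreover have "supp es f \<inter> supp es z = {} \<and> supp es f \<inter> supp es y = {} \<and> supp es z \<inter> supp es y = {}"
    using True by (auto simp: supp_def)
  moreover have "max (coeff_sup es f) (coeff_sup es z) \<le> 1 \<longleftrightarrow>
      (\<forall>n. norm (es n f) \<le> 1 \<and> norm (es n z) \<le> 1)"
    using True by (auto simp: coeff_sup_le_iff)
  ultimately show ?thesis using True unfolding Fp_admissible_def by (simp add: supp_def)
next
  case False
  then show ?thesis unfolding Fp_admissible_def by (auto simp: supp_def)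
qed

text \<open>A greedy set whose order is left implicit as its cardinality.\<close>

definition greedy_for :: "'a \<Rightarrow> nat set \<Rightarrow> bool" where
  "greedy_for f A \<longleftrightarrow> finite A \<and> (\<forall>n\<in>A. \<forall>j. j \<notin> A \<longrightarrow> norm (es j f) \<le> norm (es n f))"

lemma partially_greedy_with_iff:
  "partially_greedy_with smul e es C \<longleftrightarrow> C > 0 \<and>
     (\<forall>f A k. greedy_for f A \<and> A \<noteq> {} \<and> k \<le> card A \<longrightarrow>
        norm (f - coord_proj smul e es A f) \<le> C * norm (f - coord_proj smul e es {..<k} f))"
proof -
  have "norm x \<le> C * (INF k\<in>{0..m}. norm (g k)) \<longleftrightarrow> (\<forall>k\<le>m. norm x \<le> C * norm (g k))"
    if "C > 0" for m :: nat and x :: 'a and g :: "nat \<Rightarrow> 'a"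
  proof -
    have "norm x \<le> C * (INF k\<in>{0..m}. norm (g k)) \<longleftrightarrow> norm x / C \<le> (INF k\<in>{0..m}. norm (g k))"
      using that by (simp add: field_simps)
    also have "\<dots> \<longleftrightarrow> (\<forall>k\<in>{0..m}. norm x / C \<le> norm (g k))"
      by (rule le_cINF_iff) auto
    also have "\<dots> \<longleftrightarrow> (\<forall>k\<le>m. norm x \<le> C * norm (g k))"
      using that by (auto simp: field_simps)
    finally show ?thesis .
  qed
  moreover have "greedy_set es m f A \<and> m \<ge> 1 \<longleftrightarrow> greedy_for f A \<and> A \<noteq> {} \<and> m = card A" for m f A
    by (auto simp: greedy_set_def greedy_for_def Suc_le_eq card_gt_0_iff)
  moreover have "partially_greedy_with smul e es C \<longleftrightarrow> C > 0 \<and>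
      (\<forall>m f A. greedy_set es m f A \<and> m \<ge> 1 \<longrightarrow> norm (f - coord_proj smul e es A f)
        \<le> C * (INF k\<in>{0..m}. norm (f - coord_proj smul e es {..<k} f)))"
    unfolding partially_greedy_with_def partial_sum_def by blast
  ultimately have "partially_greedy_with smul e es C \<longleftrightarrow> C > 0 \<and>
      (\<forall>f A. greedy_for f A \<and> A \<noteq> {} \<longrightarrow> (\<forall>k\<le>card A.
        norm (f - coord_proj smul e es A f) \<le> C * norm (f - coord_proj smul e es {..<k} f)))"
    by (cases "C > 0") simp_all
  then show ?thesis by blast
qed

lemma partially_greedy_const_optimal:
  assumes "partially_greedy smul e es"
  shows "partially_greedy_with smul e es (partially_greedy_const smul e es)"
    and "partially_greedy_with smul e es C \<Longrightarrow> partially_greedy_const smul e es \<le> C"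
    and "partially_greedy_with smul e es C \<Longrightarrow> 1 \<le> C"
proof -
  define S where "S = {(norm (f - coord_proj smul e es A f), norm (f - coord_proj smul e es {..<k} f)) |
    f A k. greedy_for f A \<and> A \<noteq> {} \<and> k \<le> card A}"
  \<comment> \<open>The greedy sum of \<open>e 0 + e 1\<close> that takes \<open>e 0\<close> is also a partial sum.\<close>
  have "greedy_for (e 0 + e 1) {0}" by (auto simp: greedy_for_def es_e)
  moreover have "e 0 + e 1 - coord_proj smul e es {0} (e 0 + e 1) = e 1"
    by (rule coordinates_eqI) (auto simp: es_e)
  moreover have "e 0 + e 1 - coord_proj smul e es {..<Suc 0} (e 0 + e 1) = e 1"
    by (rule coordinates_eqI) (auto simp: es_e)
  ultimately have diag: "(norm (e 1), norm (e 1)) \<in> S"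
    unfolding S_def mem_Collect_eq
    by (intro exI[of _ "e 0 + e 1"] exI[of _ "{0}"] exI[of _ "Suc 0"]) simp
  have pos: "norm (e 1) > 0" using e_nonzero by simp
  have iff: "partially_greedy_with smul e es C \<longleftrightarrow> C > 0 \<and> (\<forall>(a, b) \<in> S. a \<le> C * b)" for C
    unfolding partially_greedy_with_iff S_def by blast
  have nonneg: "b \<ge> 0" if "(a, b) \<in> S" for a b using that by (auto simp: S_def)
  have ex: "\<exists>C. partially_greedy_with smul e es C" using assms by (simp add: partially_greedy_def)
  show "partially_greedy_with smul e es (partially_greedy_const smul e es)"
    and "partially_greedy_with smul e es C \<Longrightarrow> partially_greedy_const smul e es \<le> C"
    and "partially_greedy_with smul e es C \<Longrightarrow> 1 \<le> C"
    unfolding partially_greedy_const_def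
    using Least_ratio_bound[of "partially_greedy_with smul e es" S "norm (e 1)", OF iff nonneg diag pos ex] by simp_all
qed

lemma Fp_const_optimal:
  assumes "property_Fp es"
  shows "property_Fp_with es (Fp_const es)"
    and "property_Fp_with es C \<Longrightarrow> Fp_const es \<le> C"
proof -
  define S where "S = {(norm (f + z), norm (f + y)) | f z y. Fp_admissible es f z y}"
  have "Fp_admissible es (e 0) 0 0"
    unfolding Fp_admissible_iff in_X_fin by (auto simp: es_e)
  then have diag: "(norm (e 0), norm (e 0)) \<in> S" unfolding S_def by force
  have pos: "norm (e 0) > 0" using e_nonzero by simp
  have iff: "property_Fp_with es C \<longleftrightarrow> C > 0 \<and> (\<forall>(a, b) \<in> S. a \<le> C * b)" for C
    unfolding property_Fp_with_def S_def by blast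
  have nonneg: "b \<ge> 0" if "(a, b) \<in> S" for a b using that by (auto simp: S_def)
  have ex: "\<exists>C. property_Fp_with es C" using assms by (simp add: property_Fp_def)
  show "property_Fp_with es (Fp_const es)"
    and "property_Fp_with es C \<Longrightarrow> Fp_const es \<le> C"
    unfolding Fp_const_def
    using Least_ratio_bound[of "property_Fp_with es" S "norm (e 0)", OF iff nonneg diag pos ex] by simp_all
qed

section \<open>Partially greedy bases have Property (F)\<close>

text \<open>
  Coefficients \<open>1\<close> are put in the gaps below the support of \<open>z\<close>, so that all of \<open>{..<k}\<close> is
  occupied. The gaps together with \<open>E\<close> are then greedy, and they are at least \<open>k\<close> in number.
\<close>

lemma partially_greedy_initial_le:
  assumes pg: "partially_greedy_with smul e es C" and "finite E" "E \<noteq> {}"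
    and supp: "\<And>n. n \<in> E \<Longrightarrow> k \<le> n" "\<And>n. n \<notin> E \<Longrightarrow> es n x = 0" "\<And>n. k \<le> n \<Longrightarrow> es n z = 0"
    and big: "\<And>n. n \<in> E \<Longrightarrow> 1 \<le> norm (es n x)" and small: "\<And>n. norm (es n z) \<le> 1"
    and card: "card {n. es n z \<noteq> 0} \<le> card E"
  shows "norm z \<le> C * norm x"
proof -
  define G where "G = {n. n < k \<and> es n z = 0}"
  have fin: "finite G" by (simp add: G_def)
  define g where "g = z + x + sum e G"
  have es_g: "es n g = es n z + es n x + (if n \<in> G then 1 else 0)" for n
    using es_combination[OF fin, of n "\<lambda>_. 1"] by (simp add: g_def)
  have disj: "es n x = 0" if "n < k" for n using supp(1,2) that by force
  have "{n. es n z \<noteq> 0} \<subseteq> {..<k}" using supp(3) by (force simp: not_le)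
  then have segment: "{..<k} = {n. es n z \<noteq> 0} \<union> G" "finite {n. es n z \<noteq> 0}"
    using finite_subset[of _ "{..<k}"] by (auto simp: G_def)
  have "card {..<k} = card {n. es n z \<noteq> 0} + card G"
    unfolding segment(1) by (rule card_Un_disjoint[OF segment(2) fin]) (auto simp: G_def)
  moreover have "card (G \<union> E) = card G + card E"
    using fin \<open>finite E\<close> supp(1) by (intro card_Un_disjoint) (auto simp: G_def dest: leD)
  ultimately have k: "k \<le> card (G \<union> E)" using card by simp
  have in_set: "1 \<le> norm (es n g)" if "n \<in> G \<union> E" for n
    using that supp disj big by (auto simp: es_g G_def dest: leD)
  have out_set: "norm (es n g) \<le> 1" if "n \<notin> G \<union> E" for n
    using that supp(2) small by (simp add: es_g)
  have gr: "greedy_for g (G \<union> E)"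
    unfolding greedy_for_def using fin \<open>finite E\<close> in_set out_set by (meson finite_UnI order_trans)
  have "g - coord_proj smul e es (G \<union> E) g = z"
  proof (rule coordinates_eqI)
    fix n
    have "es n z = 0" if "n \<in> G \<union> E" using that supp by (auto simp: G_def)
    then show "es n (g - coord_proj smul e es (G \<union> E) g) = es n z"
      using fin \<open>finite E\<close> supp(2) by (auto simp: es_g)
  qed
  moreover have "g - coord_proj smul e es {..<k} g = x"
    by (rule coordinates_eqI) (use fin disj supp(3) in \<open>auto simp: es_g G_def\<close>)
  ultimately show ?thesis
    using pg gr k \<open>E \<noteq> {}\<close> unfolding partially_greedy_with_iff by (metis Un_empty)
qed

lemma partially_greedy_imp_Fp:
  assumes pg: "partially_greedy_with smul e es C"
  shows "property_Fp_with es (C * (1 + 2 * C))"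
proof -
  have C1: "1 \<le> C"
    using pg partially_greedy_const_optimal(3) by (auto simp: partially_greedy_def)
  have greedy_le: "norm (f - coord_proj smul e es A f) \<le> C * norm f" if "greedy_for f A" for f A
  proof (cases "A = {}")
    case True
    then show ?thesis using C1 mult_right_mono[of 1 C "norm f"] by (simp add: coord_proj_def)
  next
    case False
    then have "norm (f - coord_proj smul e es A f) \<le> C * norm (f - coord_proj smul e es {..<0} f)"
      using pg that unfolding partially_greedy_with_iff by blast
    then show ?thesis by (simp add: coord_proj_def)
  qed
  have "norm (f + z) \<le> C * (1 + 2 * C) * norm (f + y)" if adm: "Fp_admissible es f z y" for f z y
  proof -
    note adm' = adm[unfolded Fp_admissible_iff]
    have disj: "\<And>n. es n y \<noteq> 0 \<Longrightarrow> es n f = 0" using adm' by blast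
    have f1: "\<And>n. norm (es n f) \<le> 1" and z1: "\<And>n. norm (es n z) \<le> 1" using adm' by auto
    have card: "card {n. es n z \<noteq> 0} \<le> card {n. norm (es n y) = 1}" using adm' by blast
    have dom: "\<And>n j. es n y \<noteq> 0 \<Longrightarrow> norm (es j f) \<le> norm (es n y)" using adm' by blast
    have sep: "\<And>i j. es i z \<noteq> 0 \<Longrightarrow> es j y \<noteq> 0 \<Longrightarrow> i < j" using adm' by blast
    have finz: "finite {n. es n z \<noteq> 0}" and finy: "finite {n. es n y \<noteq> 0}"
      using adm' by (auto simp: in_X_fin)
    have "f + y - coord_proj smul e es {n. es n y \<noteq> 0} (f + y) = f"
      by (rule coordinates_eqI) (use finy disj in auto)
    moreover have "greedy_for (f + y) {n. es n y \<noteq> 0}"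
      unfolding greedy_for_def using finy disj dom by auto
    ultimately have nf: "norm f \<le> C * norm (f + y)" using greedy_le by metis
    have nz: "norm z \<le> C * ((1 + C) * norm (f + y))"
    proof (cases "z = 0")
      case True
      then show ?thesis using C1 by simp
    next
      case False
      define E where "E = {n. 1 \<le> norm (es n y)}"
      define x where "x = coord_proj smul e es E (f + y)"
      have E_y: "es n y \<noteq> 0" if "n \<in> E" for n using that by (auto simp: E_def)
      have finE: "finite E" by (rule finite_subset[OF _ finy]) (use E_y in auto)
      have es_x: "es n x = (if n \<in> E then es n y else 0)" for n
        using finE E_y disj by (auto simp: x_def)
      have small: "norm (es n (f + y)) \<le> 1" if "n \<notin> E" for n
        using that f1[of n] disj[of n] by (cases "es n y = 0") (auto simp: E_def)
      have "greedy_for (f + y) E"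
        unfolding greedy_for_def
      proof (intro conjI finE ballI allI impI)
        fix n j assume "n \<in> E" "j \<notin> E"
        have "norm (es j (f + y)) \<le> 1" by (rule small[OF \<open>j \<notin> E\<close>])
        also have "1 \<le> norm (es n (f + y))"
          using \<open>n \<in> E\<close> disj[OF E_y[OF \<open>n \<in> E\<close>]] by (simp add: E_def)
        finally show "norm (es j (f + y)) \<le> norm (es n (f + y))" .
      qed
      then have "norm (f + y - x) \<le> C * norm (f + y)"
        unfolding x_def by (rule greedy_le)
      then have nx: "norm x \<le> (1 + C) * norm (f + y)"
        using norm_triangle_ineq4[of "f + y" "f + y - x"] by (simp add: algebra_simps)
      have nez: "{n. es n z \<noteq> 0} \<noteq> {}" using False coordinates_eqI[of z 0] by auto
      have "{n. norm (es n y) = 1} \<subseteq> E" by (auto simp: E_def)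
      then have cardE: "card {n. es n z \<noteq> 0} \<le> card E"
        using card card_mono[OF finE] order_trans by blast
      have neE: "E \<noteq> {}" using cardE nez finz by auto
      define k where "k = Suc (Max {n. es n z \<noteq> 0})"
      have z0: "es n z = 0" if "k \<le> n" for n
        using that Max_ge[OF finz, of n] by (force simp: k_def)
      have "es (Max {n. es n z \<noteq> 0}) z \<noteq> 0" using Max_in[OF finz nez] by simp
      then have kE: "k \<le> n" if "n \<in> E" for n
        using sep E_y[OF that] by (simp add: k_def Suc_le_eq)
      have "norm z \<le> C * norm x"
        by (rule partially_greedy_initial_le[OF pg finE neE kE])
          (use es_x z0 z1 cardE in \<open>auto simp: E_def\<close>)
      also have "\<dots> \<le> C * ((1 + C) * norm (f + y))"
        using nx C1 by (intro mult_left_mono) auto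
      finally show ?thesis .
    qed
    have "norm (f + z) \<le> norm f + norm z" by (rule norm_triangle_ineq)
    also have "\<dots> \<le> (C + C * (1 + C)) * norm (f + y)"
      using nf nz by (simp add: algebra_simps)
    also have "\<dots> \<le> (C * (1 + 2 * C)) * norm (f + y)"
      using C1 mult_left_mono[of 1 C C] by (intro mult_right_mono) (auto simp: algebra_simps)
    finally show ?thesis .
  qed
  then show ?thesis unfolding property_Fp_with_def using C1 by simp
qed

section \<open>Bases with Property (F) are partially greedy\<close>

text \<open>
  This is Property (F) with \<open>z = 0\<close>. In that case the conditions are invariant under scaling except
  for the normalisation \<open>\<parallel>f\<parallel>\<^sub>\<infinity> \<le> 1\<close>, which a small multiple satisfies.
\<close>

lemma Fp_greedy_deletion:
  assumes F: "property_Fp_with es C" and g: "g \<in> X_fin es" and gr: "greedy_for g A"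
  shows "norm (g - coord_proj smul e es A g) \<le> C * norm g"
proof -
  define p where "p = coord_proj smul e es A g"
  have finA: "finite A" using gr by (simp add: greedy_for_def)
  have fing: "finite {n. es n g \<noteq> 0}" using g by (simp add: in_X_fin)
  have es_p: "es n p = (if n \<in> A then es n g else 0)" for n using finA by (simp add: p_def)
  \<comment> \<open>The summand \<open>1\<close> keeps \<open>M\<close> positive when \<open>g = 0\<close>.\<close>
  define M where "M = 1 + \<bar>coeff_sup es g\<bar>"
  have M0: "M > 0" by (simp add: M_def add_pos_nonneg)
  have M: "norm (es n g) \<le> M" for n
    using coeff_sup_le_iff[OF g, of "coeff_sup es g"] by (smt (verit) M_def)
  define r where "r = 1 / M"
  have r: "r > 0" "\<And>n. r * norm (es n g) \<le> 1" using M0 M by (auto simp: r_def field_simps)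
  have "Fp_admissible es (r *\<^sub>R (g - p)) 0 (r *\<^sub>R p)"
    unfolding Fp_admissible_iff
  proof (intro conjI allI impI)
    show "r *\<^sub>R (g - p) \<in> X_fin es" "r *\<^sub>R p \<in> X_fin es" "0 \<in> X_fin es"
      using X_finI[OF fing] es_p by simp_all
  next
    fix n
    show "norm (es n (r *\<^sub>R (g - p))) \<le> 1" using r(1) r(2)[of n] by (simp add: es_p)
  next
    fix n j assume "es n (r *\<^sub>R p) \<noteq> 0"
    then have "n \<in> A" by (auto simp: es_p split: if_splits)
    then show "norm (es j (r *\<^sub>R (g - p))) \<le> norm (es n (r *\<^sub>R p))"
      using gr r(1) by (auto simp: es_p greedy_for_def)
  qed (use es_p in auto)
  then have "norm (r *\<^sub>R (g - p) + 0) \<le> C * norm (r *\<^sub>R (g - p) + r *\<^sub>R p)"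
    using F unfolding property_Fp_with_def by blast
  then have "r * norm (g - p) \<le> r * (C * norm g)"
    using r(1) by (simp flip: scaleR_add_right)
  then show ?thesis using r(1) by (simp add: p_def)
qed

text \<open>
  The sign at \<open>n\<close> is the coefficient times the weight \<open>1 / |g\<^sub>n|\<close>. The subsum of the terms whose
  weight is at least \<open>t\<close> is what remains of \<open>g\<close> after deleting the coefficients larger
  than \<open>1 / t\<close>.
\<close>

lemma Fp_truncation:
  assumes F: "property_Fp_with es C" and g: "g \<in> X_fin es" and D: "finite D"
    and big: "\<And>n. n \<in> D \<Longrightarrow> 1 \<le> norm (es n g)" and small: "\<And>n. n \<notin> D \<Longrightarrow> norm (es n g) \<le> 1"
  shows "norm (g - coord_proj smul e es D g + (\<Sum>n\<in>D. smul (sgn (es n g)) (e n))) \<le> C * norm g"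
proof -
  define w where "w n = inverse (norm (es n g))" for n
  have sgn: "smul (sgn (es n g)) (e n) = w n *\<^sub>R smul (es n g) (e n)" for n
    by (metis scale_scale sgn_div_norm scaleR_conv_of_real smul_of_real w_def)
  have "norm (g - coord_proj smul e es D g + (\<Sum>n\<in>D. w n *\<^sub>R smul (es n g) (e n))) \<le> C * norm g"
  proof (rule norm_weighted_sum_le[OF D])
    show "0 \<le> w n \<and> w n \<le> 1" if "n \<in> D" for n
      using big[OF that] by (auto simp: w_def inverse_le_1_iff)
  next
    fix t :: real assume t: "0 \<le> t" "t \<le> 1"
    define L where "L = {n \<in> D. w n < t}"
    have finL: "finite L" using D by (simp add: L_def)
    have "g - coord_proj smul e es D g + (\<Sum>n\<in>{n\<in>D. t \<le> w n}. smul (es n g) (e n)) =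
        g - coord_proj smul e es L g"
      by (rule coordinates_eqI) (use D finL in \<open>auto simp: L_def\<close>)
    moreover have "greedy_for g L"
      unfolding greedy_for_def
    proof (intro conjI finL ballI allI impI)
      fix n j assume n: "n \<in> L" and j: "j \<notin> L"
      have n1: "1 \<le> norm (es n g)" "w n < t" using n big by (auto simp: L_def)
      show "norm (es j g) \<le> norm (es n g)"
      proof (cases "j \<in> D")
        case True
        then have "w n < w j" using j n1(2) by (simp add: L_def)
        then have "norm (es j g) < norm (es n g)"
          unfolding w_def by (rule inverse_less_imp_less) (use n1(1) in linarith)
        then show ?thesis by simp
      next
        case False
        then show ?thesis using small[OF False] n1 by linarith
      qed
    qed
    ultimately show "norm (g - coord_proj smul e es D g +
        (\<Sum>n\<in>{n\<in>D. t \<le> w n}. smul (es n g) (e n))) \<le> C * norm g"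
      using Fp_greedy_deletion[OF F g] by metis
  qed
  then show ?thesis by (simp add: sgn)
qed

text \<open>
  Property (F) is applied to the signs of \<open>f\<close> on \<open>A - B\<close> rather than to the coefficients
  themselves: it counts only the coefficients of \<open>y\<close> of modulus exactly \<open>1\<close>, and with signs these
  are all of \<open>A - B\<close>, which has at least as many elements as \<open>B - A\<close>.
\<close>

lemma Fp_partially_greedy_finite:
  assumes F: "property_Fp_with es C" and f: "f \<in> X_fin es" and A: "finite A"
    and big: "\<And>n. n \<in> A \<Longrightarrow> 1 \<le> norm (es n f)" and small: "\<And>n. n \<notin> A \<Longrightarrow> norm (es n f) \<le> 1"
    and k: "k \<le> card A"
  shows "norm (f - coord_proj smul e es A f) \<le> C\<^sup>2 * norm (f - coord_proj smul e es {..<k} f)"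
proof -
  define B where "B = {..<k}"
  have B: "finite B" by (simp add: B_def)
  define D where "D = A - B"
  have D: "finite D" using A by (simp add: D_def)
  define g where "g = f - coord_proj smul e es B f"
  define h where "h = f - coord_proj smul e es (A \<union> B) f"
  define z where "z = coord_proj smul e es (B - A) f"
  define y where "y = (\<Sum>n\<in>D. smul (sgn (es n f)) (e n))"
  have es_g: "es n g = (if n \<in> B then 0 else es n f)"
    and es_h: "es n h = (if n \<in> A \<union> B then 0 else es n f)"
    and es_z: "es n z = (if n \<in> B - A then es n f else 0)"
    and es_y: "es n y = (if n \<in> D then sgn (es n f) else 0)" for n
    using A B D by (auto simp: g_def h_def z_def y_def)
  have finf: "finite {n. es n f \<noteq> 0}" using f by (simp add: in_X_fin)
  have D_nz: "es n f \<noteq> 0" if "n \<in> D" for n using big[of n] that by (auto simp: D_def)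
  have "h = g - coord_proj smul e es D g"
    by (rule coordinates_eqI) (use D in \<open>auto simp: es_h es_g D_def\<close>)
  moreover have "y = (\<Sum>n\<in>D. smul (sgn (es n g)) (e n))"
    unfolding y_def by (intro sum.cong) (auto simp: es_g D_def)
  moreover have "g \<in> X_fin es" by (rule X_finI[OF finf]) (simp add: es_g)
  moreover have "1 \<le> norm (es n g)" if "n \<in> D" for n
    using that big by (simp add: es_g D_def)
  moreover have "norm (es n g) \<le> 1" if "n \<notin> D" for n
    using that small by (auto simp: es_g D_def)
  ultimately have trunc: "norm (h + y) \<le> C * norm g"
    using Fp_truncation[OF F _ D] by simp
  have "card (B - A) + card (A \<inter> B) = card B" "card D + card (A \<inter> B) = card A"
    using A B card_Diff_subset_Int[of B A] card_Diff_subset_Int[of A B]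
      card_mono[of A "A \<inter> B"] card_mono[of B "A \<inter> B"]
    by (simp_all add: D_def Int_commute)
  then have "card (B - A) \<le> card D" using k by (simp add: B_def)
  moreover have "card {n. es n z \<noteq> 0} \<le> card (B - A)"
    using B by (intro card_mono) (auto simp: es_z)
  moreover have "{n. norm (es n y) = 1} = D"
    using D_nz by (auto simp: es_y norm_sgn)
  ultimately have card: "card {n. es n z \<noteq> 0} \<le> card {n. norm (es n y) = 1}" by simp
  have "Fp_admissible es h z y"
    unfolding Fp_admissible_iff
  proof (intro conjI allI impI card)
    show "h \<in> X_fin es" "z \<in> X_fin es" by (auto intro!: X_finI[OF finf] simp: es_h es_z split: if_splits)
    show "y \<in> X_fin es" by (rule X_finI[OF D]) (simp add: es_y)
  next
    fix n
    show "es n h = 0 \<or> es n z = 0" "es n h = 0 \<or> es n y = 0" "es n z = 0 \<or> es n y = 0"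
      by (auto simp: es_h es_z es_y D_def)
    show "norm (es n h) \<le> 1" "norm (es n z) \<le> 1"
      using small by (auto simp: es_h es_z)
  next
    fix n j assume "es n y \<noteq> 0"
    then have "norm (es n y) = 1" by (auto simp: es_y norm_sgn split: if_splits)
    then show "norm (es j h) \<le> norm (es n y)" using small by (auto simp: es_h)
  next
    fix i j assume "es i z \<noteq> 0" "es j h \<noteq> 0 \<or> es j y \<noteq> 0"
    then have "i \<in> B" "j \<notin> B" by (auto simp: es_h es_z es_y D_def split: if_splits)
    then show "i < j" by (auto simp: B_def)
  qed
  then have "norm (h + z) \<le> C * norm (h + y)"
    using F unfolding property_Fp_with_def by blast
  also have "\<dots> \<le> C * (C * norm g)"
    using trunc F by (intro mult_left_mono) (auto simp: property_Fp_with_def)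
  also have "h + z = f - coord_proj smul e es A f"
    by (rule coordinates_eqI) (use A in \<open>auto simp: es_h es_z\<close>)
  finally show ?thesis by (simp add: g_def B_def power2_eq_square mult.assoc)
qed

text \<open>
  A nearby finitely supported vector has nearly the same coefficients, uniformly in the index.
  Restoring the coefficients of \<open>f\<close> on the finitely many indices that matter and shrinking the
  others slightly makes \<open>A\<close> greedy for the approximant, without spoiling the convergence.
\<close>

lemma Fp_partially_greedy_unit_level:
  assumes F: "property_Fp_with es C" and A: "finite A"
    and big: "\<And>n. n \<in> A \<Longrightarrow> 1 \<le> norm (es n f)" and small: "\<And>n. n \<notin> A \<Longrightarrow> norm (es n f) \<le> 1"
    and k: "k \<le> card A"
  shows "norm (f - coord_proj smul e es A f) \<le> C\<^sup>2 * norm (f - coord_proj smul e es {..<k} f)"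
proof -
  obtain c where c: "c > 0" "\<And>n x. norm (es n x) \<le> c * norm x" using coefficients_bounded by blast
  define d where "d j = inverse (real (Suc j))" for j
  have d0: "d j > 0" for j by (simp add: d_def)
  have d_lim: "d \<longlonglongrightarrow> 0" unfolding d_def by (rule LIMSEQ_inverse_real_of_nat)
  obtain h where h: "\<And>j. h j \<in> X_fin es" "\<And>j. norm (h j - f) < d j"
    using X_fin_dense[OF d0] by metis
  have h_lim: "h \<longlonglongrightarrow> f"
    by (rule LIMSEQ_norm_0[THEN LIM_zero_cancel])
       (use h(2) d_def in \<open>simp add: inverse_eq_divide\<close>)
  define B where "B = A \<union> {..<k}"
  have B: "finite B" using A by (simp add: B_def)
  let ?P = "coord_proj smul e es"
  define q where "q j = inverse (1 + c * d j)" for j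
  have q0: "1 + c * d j > 0" for j using c(1) d0[of j] by (simp add: add_pos_pos)
  have q_lim: "q \<longlonglongrightarrow> 1" unfolding q_def by (auto intro!: tendsto_eq_intros d_lim)
  define u where "u j = ?P B f + q j *\<^sub>R (h j - ?P B (h j))" for j
  have es_u: "es n (u j) = (if n \<in> B then es n f else q j *\<^sub>R es n (h j))" for n j
    using B by (simp add: u_def)
  have "u \<longlonglongrightarrow> ?P B f + 1 *\<^sub>R (f - ?P B f)"
    unfolding u_def
    by (intro tendsto_intros q_lim h_lim bounded_linear.tendsto[OF bounded_linear_coord_proj])
  then have u_lim: "u \<longlonglongrightarrow> f" by simp
  have same: "?P T (u j) = ?P T f" if "T \<subseteq> B" for T j
    unfolding coord_proj_def using that by (intro sum.cong) (auto simp: es_u)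
  have bound: "norm (u j - ?P A f) \<le> C\<^sup>2 * norm (u j - ?P {..<k} f)" for j
  proof -
    have "u j \<in> X_fin es"
      by (rule X_finI[of "B \<union> {n. es n (h j) \<noteq> 0}"])
        (use h(1)[of j] B in \<open>auto simp: es_u in_X_fin\<close>)
    moreover have "1 \<le> norm (es n (u j))" if "n \<in> A" for n
      using that big by (simp add: es_u B_def)
    moreover have "norm (es n (u j)) \<le> 1" if n: "n \<notin> A" for n
    proof (cases "n \<in> B")
      case True
      then show ?thesis using small[OF n] by (simp add: es_u)
    next
      case False
      have "norm (es n (h j)) \<le> norm (es n f) + norm (es n (h j - f))"
        using norm_triangle_ineq[of "es n f" "es n (h j - f)"] by simp
      also have "norm (es n (h j - f)) \<le> c * d j"
        using c(2)[of n "h j - f"] c(1) h(2)[of j] by (smt (verit) mult_left_mono)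
      finally have "norm (es n (h j)) \<le> 1 + c * d j" using small[OF n] by simp
      then show ?thesis using False q0[of j] by (simp add: es_u q_def field_simps)
    qed
    ultimately have "norm (u j - ?P A (u j)) \<le> C\<^sup>2 * norm (u j - ?P {..<k} (u j))"
      using Fp_partially_greedy_finite[OF F _ A _ _ k] by blast
    then show ?thesis by (simp add: same B_def)
  qed
  show ?thesis
  proof (rule LIMSEQ_le)
    show "(\<lambda>j. norm (u j - ?P A f)) \<longlonglongrightarrow> norm (f - ?P A f)"
      by (intro tendsto_intros u_lim)
    show "(\<lambda>j. C\<^sup>2 * norm (u j - ?P {..<k} f)) \<longlonglongrightarrow> C\<^sup>2 * norm (f - ?P {..<k} f)"
      by (intro tendsto_intros u_lim)
  qed (use bound in auto)
qed

lemma Fp_imp_partially_greedy: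
  assumes F: "property_Fp_with es C"
  shows "partially_greedy_with smul e es (C\<^sup>2)"
  unfolding partially_greedy_with_iff
proof (intro conjI allI impI)
  show "C\<^sup>2 > 0" using F by (simp add: property_Fp_with_def)
next
  fix f A k assume *: "greedy_for f A \<and> A \<noteq> {} \<and> k \<le> card A"
  then have A: "finite A" "A \<noteq> {}" and k: "k \<le> card A" by (auto simp: greedy_for_def)
  define \<alpha> where "\<alpha> = Min ((\<lambda>n. norm (es n f)) ` A)"
  have in_A: "\<alpha> \<le> norm (es n f)" if "n \<in> A" for n using that A by (simp add: \<alpha>_def)
  have "\<alpha> \<in> (\<lambda>n. norm (es n f)) ` A" unfolding \<alpha>_def using A by (intro Min_in) auto
  then have "0 \<le> \<alpha>" and out_A: "\<And>n. n \<notin> A \<Longrightarrow> norm (es n f) \<le> \<alpha>"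
    using * by (auto simp: greedy_for_def)
  show "norm (f - coord_proj smul e es A f) \<le> C\<^sup>2 * norm (f - coord_proj smul e es {..<k} f)"
  proof (cases "\<alpha> = 0")
    case True
    have "f = coord_proj smul e es A f"
      by (rule coordinates_eqI) (use A out_A True in auto)
    then have "norm (f - coord_proj smul e es A f) = 0" by simp
    then show ?thesis by simp
  next
    case False
    then have \<alpha>: "\<alpha> > 0" using \<open>0 \<le> \<alpha>\<close> by simp
    define r where "r = inverse \<alpha>"
    have r: "r > 0" using \<alpha> by (simp add: r_def)
    have "norm (r *\<^sub>R f - coord_proj smul e es A (r *\<^sub>R f)) \<le>
        C\<^sup>2 * norm (r *\<^sub>R f - coord_proj smul e es {..<k} (r *\<^sub>R f))"
      by (rule Fp_partially_greedy_unit_level[OF F A(1) _ _ k])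
        (use \<alpha> in_A out_A in \<open>auto simp: r_def field_simps\<close>)
    then have "r * norm (f - coord_proj smul e es A f) \<le>
        r * (C\<^sup>2 * norm (f - coord_proj smul e es {..<k} f))"
      using r A by (simp add: coord_proj_scaleR flip: scaleR_diff_right)
    then show ?thesis using r by simp
  qed
qed

end

section \<open>Comparison of the least constants\<close>

theorem theorem1p14:
  fixes smul :: "'k::real_normed_field \<Rightarrow> 'a::banach \<Rightarrow> 'a"
    and e :: "nat \<Rightarrow> 'a" and es :: "nat \<Rightarrow> 'a \<Rightarrow> 'k"
  assumes "banach_space_over smul"
    and "markushevich_basis smul e es"
    and "semi_normalized e es"
  shows "(partially_greedy smul e es \<longrightarrow>
            property_Fp es \<and>
            Fp_const es
              \<le> partially_greedy_const smul e es * (1 + 2 * partially_greedy_const smul e es)) \<and>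
         (property_Fp es \<longrightarrow>
            partially_greedy smul e es \<and>
            partially_greedy_const smul e es \<le> (Fp_const es)\<^sup>2)"
proof -
  interpret coordinate_basis smul e es
    using assms by (simp add: coordinate_basis_def coordinate_basis_axioms_def)
  show ?thesis
  proof (intro conjI impI)
    assume "partially_greedy smul e es"
    then have F: "property_Fp_with es
        (partially_greedy_const smul e es * (1 + 2 * partially_greedy_const smul e es))"
      by (intro partially_greedy_imp_Fp partially_greedy_const_optimal)
    then show "property_Fp es" by (auto simp: property_Fp_def)
    then show "Fp_const es
        \<le> partially_greedy_const smul e es * (1 + 2 * partially_greedy_const smul e es)"
      using F by (rule Fp_const_optimal)
  next
    assume "property_Fp es"
    then have pg: "partially_greedy_with smul e es ((Fp_const es)\<^sup>2)"
      by (intro Fp_imp_partially_greedy Fp_const_optimal)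
    then show "partially_greedy smul e es" by (auto simp: partially_greedy_def)
    then show "partially_greedy_const smul e es \<le> (Fp_const es)\<^sup>2"
      using pg by (rule partially_greedy_const_optimal)
  qed
qed

end
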